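(* Let $\Gamma$ be a connected graph with spectrum $\{[\theta_0]^1,[\theta]^n,[-\theta-1]^{n-1}\}$ having precisely two distinct valencies, whose adjacency matrix $A$ under the valency partition has block form $$A=\begin{pmatrix} A_1 & B^{\top}\\ B & A_2\end{pmatrix}\quad\text{with quotient matrix}\quad\begin{pmatrix} k_{11} & k_{12}\\ k_{21} & k_{22}\end{pmatrix},$$ where $A_1$ and $A_2$ are both $n\times n$ matrices, i.e. $n=n_1=n_2$, where $n_i$ is the number of vertices with valency $k_i$. Then the matrices $A_1$ and $J-I-A_2$ are cospectral.
   Context: All graphs are finite and simple. The spectrum is that of the adjacency matrix, where $[\theta]^m$ means that $\theta$ is an eigenvalue with multiplicity $m$; the three listed eigenvalues are the three distinct eigenvalues of $\Gamma$, with $\theta_0$ the largest. Valency means degree; the two distinct valencies are $k_1>k_2$, and the valency partition is $\{V_1,V_2\}$ with $V_i$ the set of vertices of valency $k_i$. The quotient matrix entry $k_{ij}$ is the average number of neighbours in $V_j$ of vertices of $V_i$. $J$ is the all-ones matrix and $I$ the identity matrix (of order $n$). Cospectral means having the same eigenvalues with the same multiplicities. *)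

theory Defs
  imports "Graph_Theory.Digraph_Component" "Jordan_Normal_Form.Char_Poly"
begin

text \<open>
  A finite simple graph is a symmetric loop-free digraph without parallel arcs (locale
  \<^locale>\<open>graph\<close>): an edge is a pair of opposite arcs, so the valency of a vertex is its
  \<^const>\<open>out_degree\<close>.
\<close>

text \<open>
  The adjacency matrix with rows and columns in the order given by a list that is meant to
  enumerate the vertices without repetition.
\<close>

definition adjacency_mat :: "('v, 'e) pre_digraph \<Rightarrow> 'v list \<Rightarrow> real mat" where
  "adjacency_mat G vs =
     mat (length vs) (length vs) (\<lambda>(i, j). if vs ! i \<rightarrow>\<^bsub>G\<^esub> vs ! j then 1 else 0)"

definition valency_class :: "('v, 'e) pre_digraph \<Rightarrow> nat \<Rightarrow> 'v set" where
  "valency_class G k = {v \<in> verts G. out_degree G v = k}"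

definition quotient_mat :: "('v, 'e) pre_digraph \<Rightarrow> 'v set list \<Rightarrow> real mat" where
  "quotient_mat G P =
     mat (length P) (length P)
       (\<lambda>(i, j). (\<Sum>v\<in>P ! i. real (card {w \<in> P ! j. v \<rightarrow>\<^bsub>G\<^esub> w})) / real (card (P ! i)))"

text \<open>
  Eigenvalues with their multiplicities as roots of the characteristic polynomial. This is only
  used for real symmetric matrices: all their eigenvalues are real, and algebraic and geometric
  multiplicities agree.
\<close>

definition eigenvalue_mset :: "real mat \<Rightarrow> real multiset" where
  "eigenvalue_mset M = proots (char_poly M)"

definition cospectral :: "real mat \<Rightarrow> real mat \<Rightarrow> bool" where
  "cospectral M N \<longleftrightarrow> eigenvalue_mset M = eigenvalue_mset N"

definition all_ones_mat :: "nat \<Rightarrow> real mat" where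
  "all_ones_mat n = mat n n (\<lambda>_. 1)"

end

theory Submission
  imports Defs "Jordan_Normal_Form.Schur_Decomposition" "HOL-Analysis.Convex"
begin

text \<open>
  Put \<open>M = A\<^sup>2 + A - \<theta> (\<theta> + 1) I = (A - \<theta> I) (A + (\<theta> + 1) I)\<close>. The spectrum makes \<open>M\<close> a positive
  multiple of a rank one projection with \<open>A M = \<theta>0 M\<close>, and the off-diagonal entries of \<open>M\<close> are
  nonnegative because those of \<open>A\<^sup>2 + A\<close> are; hence \<open>M = \<alpha> \<alpha>\<^sup>T\<close> with \<open>\<alpha> \<ge> 0\<close>, without an appeal to
  Perron-Frobenius. The diagonal of \<open>M\<close> shows that \<open>\<alpha>\<close> is constant on the valency classes, with values
  \<open>a1 > a2 \<ge> 0\<close>, so \<open>A \<alpha> = \<theta>0 \<alpha>\<close> forces the valency partition to be equitable, and a computation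
  gives \<open>k22 = \<theta> + a2\<^sup>2\<close>.

  As \<open>(x I - A) ((x + 1) I + A + M / (x - \<theta>0)) = (x - \<theta>) (x + \<theta> + 1) I\<close>, Jacobi's complementary minor
  identity expresses \<open>det (x I - A1)\<close> by the determinant of the lower right block of the second factor.
  That block differs from \<open>x I - (J - I - A2)\<close> by a multiple of \<open>J\<close> only, and the resulting scalar
  factors cancel.
\<close>

section \<open>Triangularization, traces and symmetric matrices\<close>

text \<open>One linear factor is divided off for each root in an enumeration of
  \<open>proots p\<close>. This turns the spectrum, given as a multiset of roots, into the factored
  form that Schur triangularization expects.\<close>

lemma prod_mset_proots:
  fixes p :: "'a :: field poly"
  assumes "monic p" "size (proots p) = degree p"
  shows "p = (\<Prod>a\<in>#proots p. [:- a, 1:])"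
proof -
  have main: "\<And>p :: 'a poly. monic p \<Longrightarrow> mset as = proots p \<Longrightarrow> size (proots p) = degree p
    \<Longrightarrow> p = (\<Prod>a\<leftarrow>as. [:- a, 1:])" for as
  proof (induction as)
    case Nil
    then have "degree p = 0" by simp
    with Nil show ?case by (metis list.simps(8) monic_degree_0 prod_list.Nil)
  next
    case (Cons a as)
    have p0: "p \<noteq> 0" using Cons.prems(1) by auto
    have "a \<in># proots p" using Cons.prems(2) by (metis list.set_intros(1) set_mset_mset)
    then have "poly p a = 0" using p0 by simp
    then obtain q where q: "p = [:- a, 1:] * q"
      by (metis dvdE poly_eq_0_iff_dvd)
    have q0: "q \<noteq> 0" using p0 q by auto
    have "monic q" using Cons.prems(1) unfolding q lead_coeff_mult by simp
    moreover have pr: "proots p = {#a#} + proots q"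
      unfolding q using q0 by (subst proots_mult) auto
    moreover have "degree p = Suc (degree q)"
      unfolding q using q0 by (subst degree_mult_eq) auto
    ultimately have "q = (\<Prod>a\<leftarrow>as. [:- a, 1:])"
      using Cons.prems by (intro Cons.IH) auto
    with q show ?case by simp
  qed
  obtain as where "mset as = proots p" using ex_mset by blast
  with main[OF assms(1) this assms(2)] show ?thesis
    by (metis mset_map prod_mset_prod_list)
qed

definition mat_trace :: "'a :: comm_monoid_add mat \<Rightarrow> 'a" where
  "mat_trace A = (\<Sum>i<dim_row A. A $$ (i, i))"

lemma mat_trace_mult_commute:
  fixes A B :: "'a :: comm_semiring_0 mat"
  assumes "A \<in> carrier_mat n m" "B \<in> carrier_mat m n"
  shows "mat_trace (A * B) = mat_trace (B * A)"
proof -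
  have "mat_trace (A * B) = (\<Sum>i<n. \<Sum>k<m. A $$ (i, k) * B $$ (k, i))"
    using assms by (auto simp: mat_trace_def scalar_prod_def atLeast0LessThan intro!: sum.cong)
  also have "\<dots> = (\<Sum>k<m. \<Sum>i<n. B $$ (k, i) * A $$ (i, k))"
    by (subst sum.swap) (simp add: mult.commute)
  also have "\<dots> = mat_trace (B * A)"
    using assms by (auto simp: mat_trace_def scalar_prod_def atLeast0LessThan intro!: sum.cong)
  finally show ?thesis .
qed

lemma mat_trace_similar:
  fixes A :: "'a :: comm_ring_1 mat"
  assumes "similar_mat_wit A B P Q"
  shows "mat_trace A = mat_trace B"
proof -
  obtain n where n: "n = dim_row A" by simp
  note w = similar_mat_witD[OF n assms]
  have "mat_trace A = mat_trace ((P * B) * Q)" by (simp only: w(3))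
  also have "\<dots> = mat_trace (Q * (P * B))"
    by (rule mat_trace_mult_commute[of _ n n]) (use w(5-7) in auto)
  also have "Q * (P * B) = Q * P * B"
    by (rule assoc_mult_mat[symmetric, OF w(7,6,5)])
  also have "\<dots> = B" unfolding w(2) using w(5) by simp
  finally show ?thesis .
qed

lemma upper_triangular_mult:
  fixes A B :: "'a :: semiring_0 mat"
  assumes c: "A \<in> carrier_mat n n" "B \<in> carrier_mat n n"
    and ut: "upper_triangular A" "upper_triangular B"
  shows "upper_triangular (A * B)"
    and "i < n \<Longrightarrow> (A * B) $$ (i, i) = A $$ (i, i) * B $$ (i, i)"
proof -
  \<comment> \<open>A nonzero term needs \<open>i \<le> k\<close> and \<open>k \<le> j\<close>; for
    \<open>j \<le> i\<close> this leaves only \<open>i = k = j\<close>.\<close>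
  have z: "A $$ (i, k) * B $$ (k, j) = 0" if "j \<le> i" "i < n" "k < n" "k \<noteq> i \<or> k \<noteq> j" for i j k
    using that c upper_triangularD[OF ut(1), of k i] upper_triangularD[OF ut(2), of j k]
    by (cases "k < i") auto
  have e: "(A * B) $$ (i, j) = (\<Sum>k<n. A $$ (i, k) * B $$ (k, j))" if "i < n" "j < n" for i j
    using c that by (auto simp: scalar_prod_def atLeast0LessThan intro!: sum.cong)
  show "upper_triangular (A * B)"
  proof
    fix i j assume "j < i" "i < dim_row (A * B)"
    with c show "(A * B) $$ (i, j) = 0" by (subst e) (auto intro!: sum.neutral z)
  qed
  assume i: "i < n"
  have "(\<Sum>k<n. A $$ (i, k) * B $$ (k, i)) = (\<Sum>k\<in>{i}. A $$ (i, k) * B $$ (k, i))"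
    using i by (intro sum.mono_neutral_right) (auto intro!: z)
  with e[OF i i] show "(A * B) $$ (i, i) = A $$ (i, i) * B $$ (i, i)" by simp
qed

text \<open>For a symmetric matrix, the trace of the square is the sum of the squares of all
  entries.\<close>

lemma symmetric_square_trace_zero:
  fixes A :: "real mat"
  assumes A: "A \<in> carrier_mat n n" and sym: "transpose_mat A = A" and tr: "mat_trace (A * A) = 0"
  shows "A = 0\<^sub>m n n"
proof -
  have sij: "A $$ (k, i) = A $$ (i, k)" if "i < n" "k < n" for i k
    using A that by (subst sym[symmetric]) auto
  have "(\<Sum>i<n. \<Sum>k<n. (A $$ (i, k))\<^sup>2) = mat_trace (A * A)"
    using A by (auto simp: mat_trace_def scalar_prod_def atLeast0LessThan power2_eq_square sij
        intro!: sum.cong)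
  then have z: "(\<Sum>i<n. \<Sum>k<n. (A $$ (i, k))\<^sup>2) = 0" using tr by simp
  have "\<forall>i\<in>{..<n}. (\<Sum>k<n. (A $$ (i, k))\<^sup>2) = 0"
    using z by (subst (asm) sum_nonneg_eq_0_iff) (auto intro!: sum_nonneg)
  then have "A $$ (i, k) = 0" if "i < n" "k < n" for i k
    using that by (auto simp: sum_nonneg_eq_0_iff)
  then show ?thesis using A by (intro eq_matI) auto
qed

text \<open>Keeping the same \<open>P\<close> and \<open>Q\<close> lets several polynomials in one
  matrix be triangularized simultaneously, so that their diagonals multiply entrywise.\<close>

lemma similar_mat_wit_mult:
  fixes A :: "'a :: comm_ring_1 mat"
  assumes A: "A \<in> carrier_mat n n" and C: "C \<in> carrier_mat n n"
    and "similar_mat_wit A B P Q" "similar_mat_wit C D P Q"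
  shows "similar_mat_wit (A * C) (B * D) P Q"
proof -
  note w = similar_mat_witD2[OF A assms(3)] and v = similar_mat_witD2[OF C assms(4)]
  note c = w(5-7) v(5)
  have "A * C = (P * B * Q) * (P * D * Q)" using w(3) v(3) by simp
  also have "\<dots> = P * B * (Q * P * (D * Q))"
    using c by (simp add: assoc_mult_mat[of _ n n _ n _ n])
  also have "\<dots> = P * (B * D) * Q"
    using c by (simp add: w(2) assoc_mult_mat[of _ n n _ n _ n])
  finally show ?thesis using A C c w(1,2) by (intro similar_mat_witI[of _ _ n]) auto
qed

lemma similar_mat_wit_shift:
  fixes A :: "'a :: comm_ring_1 mat"
  assumes A: "A \<in> carrier_mat n n" and "similar_mat_wit A B P Q"
  shows "similar_mat_wit (A - c \<cdot>\<^sub>m 1\<^sub>m n) (B - c \<cdot>\<^sub>m 1\<^sub>m n) P Q"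
proof -
  note w = similar_mat_witD2[OF A assms(2)]
  note cs = w(5-7)
  have "P * (B - c \<cdot>\<^sub>m 1\<^sub>m n) * Q = (P * B - c \<cdot>\<^sub>m P) * Q"
    using cs by (simp add: mult_minus_distrib_mat[of _ n n _ n] mult_smult_distrib[of _ n n _ n])
  also have "\<dots> = P * B * Q - c \<cdot>\<^sub>m (P * Q)"
    using cs by (simp add: minus_mult_distrib_mat[of _ n n _ _ n] mult_smult_assoc_mat[of _ n n _ n])
  also have "\<dots> = A - c \<cdot>\<^sub>m 1\<^sub>m n" by (simp only: w(1,3))
  finally show ?thesis using A cs w(1,2) by (intro similar_mat_witI[of _ _ n]) auto
qed

lemma triangularization:
  fixes A :: "'a :: conjugatable_ordered_field mat"
  assumes "A \<in> carrier_mat n n" "char_poly A = (\<Prod>e\<leftarrow>es. [:- e, 1:])"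
  obtains B P Q where "similar_mat_wit A B P Q" "upper_triangular B" "diag_mat B = es"
  using schur_decomposition[OF assms] by (metis prod_cases3)

lemma upper_triangular_minus_smult_one:
  "B \<in> carrier_mat n n \<Longrightarrow> upper_triangular B \<Longrightarrow> upper_triangular (B - c \<cdot>\<^sub>m 1\<^sub>m n)"
  for B :: "'a :: comm_ring_1 mat"
  by (intro upper_triangularI) (auto dest: upper_triangularD)

lemma minus_smult_one_mult:
  fixes A :: "'a :: comm_ring_1 mat"
  assumes A: "A \<in> carrier_mat n n"
  shows "(A - a \<cdot>\<^sub>m 1\<^sub>m n) * (A - b \<cdot>\<^sub>m 1\<^sub>m n) = A * A - (a + b) \<cdot>\<^sub>m A + (a * b) \<cdot>\<^sub>m 1\<^sub>m n"
proof -
  have X: "A - b \<cdot>\<^sub>m 1\<^sub>m n \<in> carrier_mat n n" using A by auto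
  have "(A - a \<cdot>\<^sub>m 1\<^sub>m n) * (A - b \<cdot>\<^sub>m 1\<^sub>m n)
      = A * (A - b \<cdot>\<^sub>m 1\<^sub>m n) - a \<cdot>\<^sub>m (A - b \<cdot>\<^sub>m 1\<^sub>m n)"
    using A X by (subst minus_mult_distrib_mat[of _ n n _ _ n])
      (auto simp: mult_smult_assoc_mat[OF one_carrier_mat X])
  also have "A * (A - b \<cdot>\<^sub>m 1\<^sub>m n) = A * A - b \<cdot>\<^sub>m A"
    using A by (simp add: mult_minus_distrib_mat[of _ n n _ n] mult_smult_distrib[of _ n n _ n])
  also have "A * A - b \<cdot>\<^sub>m A - a \<cdot>\<^sub>m (A - b \<cdot>\<^sub>m 1\<^sub>m n)
      = A * A - (a + b) \<cdot>\<^sub>m A + (a * b) \<cdot>\<^sub>m 1\<^sub>m n"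
    using A by (intro eq_matI) (auto simp: algebra_simps)
  finally show ?thesis .
qed

lemma minus_smult_one_commute:
  fixes A :: "'a :: comm_ring_1 mat"
  assumes A: "A \<in> carrier_mat n n"
  shows "(A - a \<cdot>\<^sub>m 1\<^sub>m n) * (A - b \<cdot>\<^sub>m 1\<^sub>m n) = (A - b \<cdot>\<^sub>m 1\<^sub>m n) * (A - a \<cdot>\<^sub>m 1\<^sub>m n)"
  unfolding minus_smult_one_mult[OF A] by (simp add: add.commute mult.commute)

text \<open>The product \<open>N\<close> of the commuting symmetric factors is symmetric. It is
  similar to a triangular matrix \<open>U\<close> whose diagonal vanishes, because every diagonal
  entry of the triangular form of \<open>A\<close> is a root of one factor. So \<open>N * N\<close>
  has trace zero, which forces \<open>N = 0\<close>. Triangularization and traces thus do the work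
  of diagonalization.\<close>

lemma symmetric_mat_annihilated:
  fixes A :: "real mat"
  assumes A: "A \<in> carrier_mat n n" and sym: "transpose_mat A = A"
    and cp: "char_poly A = (\<Prod>e\<leftarrow>es. [:- e, 1:])" and es: "set es \<subseteq> {a, b, c}"
  shows "(A - a \<cdot>\<^sub>m 1\<^sub>m n) * ((A - b \<cdot>\<^sub>m 1\<^sub>m n) * (A - c \<cdot>\<^sub>m 1\<^sub>m n)) = 0\<^sub>m n n"
proof -
  define S where "S x = A - x \<cdot>\<^sub>m 1\<^sub>m n" for x
  have S: "S x \<in> carrier_mat n n" for x using A by (auto simp: S_def)
  have comm: "S x * S y = S y * S x" for x y
    unfolding S_def by (rule minus_smult_one_commute[OF A])
  have St: "transpose_mat (S x) = S x" for x
  proof -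
    have "A $$ (j, i) = A $$ (i, j)" if "i < n" "j < n" for i j
      using A that by (subst sym[symmetric]) auto
    then show ?thesis using A by (intro eq_matI) (auto simp: S_def)
  qed
  define N where "N = S a * (S b * S c)"
  have N: "N \<in> carrier_mat n n" unfolding N_def by (intro mult_carrier_mat[of _ n n] S)
  have assoc: "X * Y * Z = X * (Y * Z)"
    if "X \<in> carrier_mat n n" "Y \<in> carrier_mat n n" "Z \<in> carrier_mat n n" for X Y Z :: "real mat"
    using that by (rule assoc_mult_mat)
  have "transpose_mat N = S c * S b * S a"
    unfolding N_def by (simp add: transpose_mult[OF S mult_carrier_mat[OF S S]] transpose_mult[OF S S] St)
  also have "\<dots> = S b * S c * S a" by (simp only: comm[of c b])
  also have "\<dots> = S b * (S a * S c)" by (simp only: assoc S comm[of c a])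
  also have "\<dots> = S b * S a * S c" by (simp only: assoc S)
  also have "\<dots> = N" by (simp only: comm[of b a] assoc S N_def)
  finally have Nt: "transpose_mat N = N" .
  obtain T P Q where w: "similar_mat_wit A T P Q" and T: "upper_triangular T" and d: "diag_mat T = es"
    using triangularization[OF A cp] by blast
  note Tc = similar_mat_witD2(5)[OF A w]
  define R where "R x = T - x \<cdot>\<^sub>m 1\<^sub>m n" for x
  have R: "R x \<in> carrier_mat n n" "upper_triangular (R x)" for x
    using Tc T by (auto simp: R_def intro: upper_triangular_minus_smult_one)
  have wR: "similar_mat_wit (S x) (R x) P Q" for x
    unfolding S_def R_def by (rule similar_mat_wit_shift[OF A w])
  define U where "U = R a * (R b * R c)"
  have bc: "R b * R c \<in> carrier_mat n n" "upper_triangular (R b * R c)"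
    using R upper_triangular_mult(1)[of "R b" n "R c"] mult_carrier_mat[OF R(1) R(1)] by auto
  have U: "U \<in> carrier_mat n n" "upper_triangular U"
    unfolding U_def using R bc upper_triangular_mult(1)[of "R a" n "R b * R c"]
      mult_carrier_mat[OF R(1) bc(1)] by auto
  have Uii: "U $$ (i, i) = 0" if i: "i < n" for i
  proof -
    have "T $$ (i, i) \<in> set es" using i Tc unfolding d[symmetric] diag_mat_def by auto
    then have "T $$ (i, i) = a \<or> T $$ (i, i) = b \<or> T $$ (i, i) = c" using es by auto
    then have "R a $$ (i, i) * (R b $$ (i, i) * R c $$ (i, i)) = 0"
      using i Tc by (auto simp: R_def)
    then show ?thesis unfolding U_def
      using upper_triangular_mult(2)[OF R(1) bc(1) R(2) bc(2) i]
        upper_triangular_mult(2)[OF R(1) R(1) R(2) R(2) i] by simp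
  qed
  have "similar_mat_wit N U P Q" unfolding N_def U_def
    by (intro similar_mat_wit_mult[of _ n] wR S mult_carrier_mat[of _ n n])
  then have "similar_mat_wit (N * N) (U * U) P Q"
    by (intro similar_mat_wit_mult[of _ n] N)
  then have "mat_trace (N * N) = mat_trace (U * U)" by (rule mat_trace_similar)
  also have "\<dots> = 0"
    using U(1) Uii upper_triangular_mult(2)[OF U(1) U(1) U(2) U(2)]
    by (auto simp: mat_trace_def simp del: index_mult_mat(1) intro!: sum.neutral)
  finally have "N = 0\<^sub>m n n" by (intro symmetric_square_trace_zero N Nt)
  then show ?thesis by (simp add: N_def S_def)
qed

text \<open>Both traces are read off a triangular form with diagonal \<open>es\<close>: similarity
  preserves traces, and diagonals of triangular matrices multiply entrywise.\<close>

lemma mat_trace_char_poly: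
  fixes A :: "'a :: conjugatable_ordered_field mat"
  assumes A: "A \<in> carrier_mat n n" and cp: "char_poly A = (\<Prod>e\<leftarrow>es. [:- e, 1:])"
  shows "mat_trace A = sum_list es"
    and "mat_trace ((A - a \<cdot>\<^sub>m 1\<^sub>m n) * (A - b \<cdot>\<^sub>m 1\<^sub>m n)) = (\<Sum>e\<leftarrow>es. (e - a) * (e - b))"
proof -
  obtain T P Q where w: "similar_mat_wit A T P Q" and T: "upper_triangular T" and d: "diag_mat T = es"
    using triangularization[OF A cp] by blast
  note Tc = similar_mat_witD2(5)[OF A w]
  show "mat_trace A = sum_list es"
    unfolding mat_trace_similar[OF w] d[symmetric] using Tc
    by (simp add: mat_trace_def diag_mat_def interv_sum_list_conv_sum_set_nat atLeast0LessThan)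
  define R where "R x = T - x \<cdot>\<^sub>m 1\<^sub>m n" for x
  have R: "R x \<in> carrier_mat n n" "upper_triangular (R x)" for x
    using Tc T by (auto simp: R_def intro: upper_triangular_minus_smult_one)
  have "similar_mat_wit ((A - a \<cdot>\<^sub>m 1\<^sub>m n) * (A - b \<cdot>\<^sub>m 1\<^sub>m n)) (R a * R b) P Q"
    unfolding R_def using A by (intro similar_mat_wit_mult[of _ n] similar_mat_wit_shift[OF A w]) auto
  then have "mat_trace ((A - a \<cdot>\<^sub>m 1\<^sub>m n) * (A - b \<cdot>\<^sub>m 1\<^sub>m n)) = mat_trace (R a * R b)"
    by (rule mat_trace_similar)
  also have "\<dots> = (\<Sum>i<n. R a $$ (i, i) * R b $$ (i, i))"
    using R(1)[of a] upper_triangular_mult(2)[OF R(1) R(1) R(2) R(2)]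
    unfolding mat_trace_def by (intro sum.cong) auto
  also have "\<dots> = (\<Sum>i<n. (T $$ (i, i) - a) * (T $$ (i, i) - b))"
    using Tc by (intro sum.cong) (auto simp: R_def)
  also have "\<dots> = (\<Sum>e\<leftarrow>es. (e - a) * (e - b))"
    unfolding d[symmetric] using Tc
    by (simp add: diag_mat_def interv_sum_list_conv_sum_set_nat atLeast0LessThan comp_def)
  finally show "mat_trace ((A - a \<cdot>\<^sub>m 1\<^sub>m n) * (A - b \<cdot>\<^sub>m 1\<^sub>m n)) = (\<Sum>e\<leftarrow>es. (e - a) * (e - b))" .
qed

section \<open>Rank one from the trace of a scaled projection\<close>

text \<open>
  Cauchy-Schwarz gives \<open>(M i j)\<^sup>2 \<le> M i i * M j j\<close>; summed over all \<open>i\<close> and \<open>j\<close>, both sides give \<open>\<phi>\<^sup>2\<close>,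
  so all these inequalities are equalities.
\<close>

lemma projection_trace_rank_one:
  fixes M :: "nat \<Rightarrow> nat \<Rightarrow> real"
  assumes \<phi>: "\<phi> > 0"
    and sym: "\<And>i j. i < n \<Longrightarrow> j < n \<Longrightarrow> M i j = M j i"
    and sq: "\<And>i j. i < n \<Longrightarrow> j < n \<Longrightarrow> (\<Sum>k<n. M i k * M k j) = \<phi> * M i j"
    and tr: "(\<Sum>i<n. M i i) = \<phi>"
    and ij: "i < n" "j < n"
  shows "(M i j)\<^sup>2 = M i i * M j j" and "M i i \<ge> 0"
proof -
  have row: "(\<Sum>k<n. (M i k)\<^sup>2) = \<phi> * M i i" if "i < n" for i
    using sq[OF that that] sym[OF that] by (simp add: power2_eq_square)
  have "0 \<le> \<phi> * M i i" unfolding row[OF ij(1), symmetric] by (intro sum_nonneg) auto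
  then show "M i i \<ge> 0" using \<phi> by (simp add: zero_le_mult_iff)
  have le: "(M i j)\<^sup>2 \<le> M i i * M j j" if ij: "i < n" "j < n" for i j
  proof -
    have "\<phi>\<^sup>2 * (M i j)\<^sup>2 = (\<Sum>k<n. M i k * M j k)\<^sup>2"
      using sq[OF ij] sym[OF ij(2)] by (simp add: power_mult_distrib)
    also have "\<dots> \<le> (\<Sum>k<n. (M i k)\<^sup>2) * (\<Sum>k<n. (M j k)\<^sup>2)"
      by (rule Cauchy_Schwarz_ineq_sum)
    also have "\<dots> = \<phi>\<^sup>2 * (M i i * M j j)"
      using row ij by (simp add: power2_eq_square)
    finally show ?thesis using \<phi> by (simp add: mult_le_cancel_left)
  qed
  have "(\<Sum>i<n. \<Sum>j<n. (M i j)\<^sup>2) = (\<Sum>i<n. \<phi> * M i i)"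
    using row by (intro sum.cong) auto
  also have "\<dots> = \<phi> * \<phi>" unfolding sum_distrib_left[symmetric] tr ..
  also have "\<dots> = (\<Sum>i<n. \<Sum>j<n. M i i * M j j)"
    by (simp add: tr[symmetric] sum_product)
  finally have "(\<Sum>i<n. \<Sum>j<n. M i i * M j j - (M i j)\<^sup>2) = 0"
    by (simp add: sum_subtractf)
  then have "\<forall>i\<in>{..<n}. (\<Sum>j<n. M i i * M j j - (M i j)\<^sup>2) = 0"
    using le by (subst (asm) sum_nonneg_eq_0_iff) (auto intro!: sum_nonneg)
  then have "(\<Sum>j<n. M i i * M j j - (M i j)\<^sup>2) = 0" using ij by auto
  then have "\<forall>j\<in>{..<n}. M i i * M j j - (M i j)\<^sup>2 = 0"
    using le ij by (subst (asm) sum_nonneg_eq_0_iff) auto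
  then show "(M i j)\<^sup>2 = M i i * M j j" using ij by auto
qed

section \<open>Complementary minors\<close>

lemma four_block_mat_eqD:
  assumes eq: "four_block_mat A B C D = four_block_mat A' B' C' D'"
    and c: "A \<in> carrier_mat n1 m1" "B \<in> carrier_mat n1 m2" "C \<in> carrier_mat n2 m1" "D \<in> carrier_mat n2 m2"
      "A' \<in> carrier_mat n1 m1" "B' \<in> carrier_mat n1 m2" "C' \<in> carrier_mat n2 m1" "D' \<in> carrier_mat n2 m2"
  shows "A = A'" "B = B'" "C = C'" "D = D'"
proof -
  have e: "four_block_mat A B C D $$ (i, j) = four_block_mat A' B' C' D' $$ (i, j)" for i j
    using eq by simp
  show "A = A'"
  proof (rule eq_matI)
    fix i j assume "i < dim_row A'" "j < dim_col A'"
    with e[of i j] c show "A $$ (i, j) = A' $$ (i, j)" by auto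
  qed (use c in auto)
  show "B = B'"
  proof (rule eq_matI)
    fix i j assume "i < dim_row B'" "j < dim_col B'"
    with e[of i "m1 + j"] c show "B $$ (i, j) = B' $$ (i, j)" by auto
  qed (use c in auto)
  show "C = C'"
  proof (rule eq_matI)
    fix i j assume "i < dim_row C'" "j < dim_col C'"
    with e[of "n1 + i" j] c show "C $$ (i, j) = C' $$ (i, j)" by auto
  qed (use c in auto)
  show "D = D'"
  proof (rule eq_matI)
    fix i j assume "i < dim_row D'" "j < dim_col D'"
    with e[of "n1 + i" "m1 + j"] c show "D $$ (i, j) = D' $$ (i, j)" by auto
  qed (use c in auto)
qed

text \<open>Jacobi's identity in a form free of inverses. \<open>?Y\<close> keeps the second block
  column of the right factor and replaces the first by that of the identity. Then
  \<open>?M * ?Y\<close> is block triangular with diagonal blocks \<open>M11\<close> and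
  \<open>f\<close> times the identity, while \<open>det ?Y = det X22\<close>; it remains to take
  determinants.\<close>

lemma det_complementary_block:
  fixes M11 :: "'a :: idom mat"
  assumes M: "M11 \<in> carrier_mat n n" "M12 \<in> carrier_mat n m" "M21 \<in> carrier_mat m n" "M22 \<in> carrier_mat m m"
    and X: "X11 \<in> carrier_mat n n" "X12 \<in> carrier_mat n m" "X21 \<in> carrier_mat m n" "X22 \<in> carrier_mat m m"
    and prod: "four_block_mat M11 M12 M21 M22 * four_block_mat X11 X12 X21 X22 = f \<cdot>\<^sub>m 1\<^sub>m (n + m)"
  shows "det (four_block_mat M11 M12 M21 M22) * det X22 = det M11 * f ^ m"
proof -
  let ?M = "four_block_mat M11 M12 M21 M22"
  let ?Y = "four_block_mat (1\<^sub>m n) X12 (0\<^sub>m m n) X22"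
  have "f \<cdot>\<^sub>m 1\<^sub>m (n + m) = four_block_mat (f \<cdot>\<^sub>m 1\<^sub>m n) (0\<^sub>m n m) (0\<^sub>m m n) (f \<cdot>\<^sub>m 1\<^sub>m m)"
    by (intro eq_matI) auto
  then have "four_block_mat (M11 * X11 + M12 * X21) (M11 * X12 + M12 * X22)
      (M21 * X11 + M22 * X21) (M21 * X12 + M22 * X22)
    = four_block_mat (f \<cdot>\<^sub>m 1\<^sub>m n) (0\<^sub>m n m) (0\<^sub>m m n) (f \<cdot>\<^sub>m 1\<^sub>m m)"
    using prod mult_four_block_mat[OF M X] by simp
  note D = four_block_mat_eqD[OF this, of n n m m]
  have 12: "M11 * X12 + M12 * X22 = 0\<^sub>m n m" and 22: "M21 * X12 + M22 * X22 = f \<cdot>\<^sub>m 1\<^sub>m m"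
    by (rule D; use M X in auto)+
  have "?M * ?Y = four_block_mat (M11 * 1\<^sub>m n + M12 * 0\<^sub>m m n) (M11 * X12 + M12 * X22)
      (M21 * 1\<^sub>m n + M22 * 0\<^sub>m m n) (M21 * X12 + M22 * X22)"
    by (rule mult_four_block_mat) (use M X in auto)
  also have "\<dots> = four_block_mat M11 (0\<^sub>m n m) M21 (f \<cdot>\<^sub>m 1\<^sub>m m)"
    using M unfolding 12 22 by simp
  finally have "det (?M * ?Y) = det (four_block_mat M11 (0\<^sub>m n m) M21 (f \<cdot>\<^sub>m 1\<^sub>m m))" by simp
  also have "\<dots> = det M11 * f ^ m"
    using M by (subst det_four_block_mat_upper_right_zero) auto
  also have "det (?M * ?Y) = det ?M * det ?Y"
    by (rule det_mult[of _ "n + m"]) (use M X in auto)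
  also have "det ?Y = det X22"
    using X by (subst det_four_block_mat_lower_left_zero) auto
  finally show ?thesis .
qed

text \<open>The bordered matrix \<open>?F\<close> is factored in two ways. Eliminating its upper
  left block leaves the scalar Schur complement \<open>?s\<close>; eliminating its lower right entry
  leaves \<open>?W\<close>. Comparing determinants gives the formula.\<close>

lemma det_one_plus_const:
  fixes t :: "'a :: idom"
  shows "det (1\<^sub>m n + mat n n (\<lambda>_. t)) = 1 + of_nat n * t"
proof -
  let ?u = "mat n 1 (\<lambda>_. - t)" and ?v = "mat 1 n (\<lambda>_. 1 :: 'a)"
  let ?F = "four_block_mat (1\<^sub>m n) ?u ?v (1\<^sub>m 1)"
  let ?L = "four_block_mat (1\<^sub>m n) (0\<^sub>m n 1) ?v (1\<^sub>m 1)"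
  let ?s = "mat 1 1 (\<lambda>_. 1 + of_nat n * t)"
  have "?L * four_block_mat (1\<^sub>m n) ?u (0\<^sub>m 1 n) ?s
     = four_block_mat (1\<^sub>m n * 1\<^sub>m n + 0\<^sub>m n 1 * 0\<^sub>m 1 n) (1\<^sub>m n * ?u + 0\<^sub>m n 1 * ?s)
       (?v * 1\<^sub>m n + 1\<^sub>m 1 * 0\<^sub>m 1 n) (?v * ?u + 1\<^sub>m 1 * ?s)"
    by (rule mult_four_block_mat) auto
  also have "?v * ?u + 1\<^sub>m 1 * ?s = 1\<^sub>m 1"
    by (intro eq_matI) (auto simp: scalar_prod_def)
  finally have 1: "?L * four_block_mat (1\<^sub>m n) ?u (0\<^sub>m 1 n) ?s = ?F"
    by (simp add: right_mult_one_mat[of _ 1 n] left_mult_one_mat[of _ n 1])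
  have "det (?L * four_block_mat (1\<^sub>m n) ?u (0\<^sub>m 1 n) ?s)
      = det ?L * det (four_block_mat (1\<^sub>m n) ?u (0\<^sub>m 1 n) ?s)"
    by (rule det_mult[of _ "n + 1"]) auto
  also have "det ?L = 1" by (subst det_four_block_mat_upper_right_zero) auto
  also have "det (four_block_mat (1\<^sub>m n) ?u (0\<^sub>m 1 n) ?s) = 1 + of_nat n * t"
    by (subst det_four_block_mat_lower_left_zero) (auto simp: det_single)
  finally have d1: "det ?F = 1 + of_nat n * t" unfolding 1 by simp
  let ?W = "1\<^sub>m n + mat n n (\<lambda>_. t)"
  let ?K = "four_block_mat (1\<^sub>m n) ?u (0\<^sub>m 1 n) (1\<^sub>m 1)"
  have "?K * four_block_mat ?W (0\<^sub>m n 1) ?v (1\<^sub>m 1)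
     = four_block_mat (1\<^sub>m n * ?W + ?u * ?v) (1\<^sub>m n * 0\<^sub>m n 1 + ?u * 1\<^sub>m 1)
       (0\<^sub>m 1 n * ?W + 1\<^sub>m 1 * ?v) (0\<^sub>m 1 n * 0\<^sub>m n 1 + 1\<^sub>m 1 * 1\<^sub>m 1)"
    by (rule mult_four_block_mat) auto
  also have "1\<^sub>m n * ?W + ?u * ?v = 1\<^sub>m n"
    by (intro eq_matI) (auto simp: scalar_prod_def left_mult_one_mat[of _ n n])
  finally have 2: "?K * four_block_mat ?W (0\<^sub>m n 1) ?v (1\<^sub>m 1) = ?F"
    by (simp add: right_mult_one_mat[of _ n 1] left_mult_one_mat[of _ 1 n]
        left_mult_one_mat[of _ n 1] left_mult_zero_mat[of _ n n])
  have "det (?K * four_block_mat ?W (0\<^sub>m n 1) ?v (1\<^sub>m 1))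
      = det ?K * det (four_block_mat ?W (0\<^sub>m n 1) ?v (1\<^sub>m 1))"
    by (rule det_mult[of _ "n + 1"]) auto
  also have "det ?K = 1" by (subst det_four_block_mat_lower_left_zero) auto
  also have "det (four_block_mat ?W (0\<^sub>m n 1) ?v (1\<^sub>m 1)) = det ?W"
    by (subst det_four_block_mat_upper_right_zero) auto
  finally show ?thesis using d1 unfolding 2 by simp
qed

text \<open>Constant row sums \<open>r\<close> mean \<open>D J = r J\<close> for the all-ones matrix
  \<open>J\<close>, so \<open>D + s J = D (I + (s / r) J)\<close>.\<close>

lemma det_plus_const:
  fixes D :: "'a :: field mat"
  assumes D: "D \<in> carrier_mat n n"
    and rows: "\<And>i. i < n \<Longrightarrow> (\<Sum>j<n. D $$ (i, j)) = r" and r: "r \<noteq> 0"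
  shows "det (D + mat n n (\<lambda>_. s)) = det D * (1 + of_nat n * (s / r))"
proof -
  let ?t = "s / r"
  have "D + mat n n (\<lambda>_. s) = D * (1\<^sub>m n + mat n n (\<lambda>_. ?t))"
  proof (rule eq_matI, goal_cases)
    case (1 i j)
    then have i: "i < n" and j: "j < n" using D by auto
    have "D * (1\<^sub>m n + mat n n (\<lambda>_. ?t)) = D + D * mat n n (\<lambda>_. ?t)"
      using D by (subst mult_add_distrib_mat[of _ n n _ n]) auto
    moreover have "(D * mat n n (\<lambda>_. ?t)) $$ (i, j) = (\<Sum>k<n. D $$ (i, k) * ?t)"
      using D i j by (auto simp: scalar_prod_def atLeast0LessThan intro!: sum.cong)
    moreover have "\<dots> = s" using rows[OF i] r unfolding sum_distrib_right[symmetric] by simp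
    ultimately show ?case using D i j by (simp del: index_mult_mat(1))
  qed (use D in auto)
  then have "det (D + mat n n (\<lambda>_. s)) = det D * det (1\<^sub>m n + mat n n (\<lambda>_. ?t))"
    using D by (simp add: det_mult[of _ n])
  then show ?thesis by (simp only: det_one_plus_const)
qed

lemma poly_char_poly:
  fixes A :: "'a :: field mat"
  assumes "A \<in> carrier_mat n n"
  shows "poly (char_poly A) x = det (x \<cdot>\<^sub>m 1\<^sub>m n - A)"
proof -
  have "- char_matrix A x = x \<cdot>\<^sub>m 1\<^sub>m n - A"
    using assms by (intro eq_matI) (auto simp: char_matrix_def)
  then show ?thesis using char_poly_matrix[OF assms] by simp
qed

section \<open>Graphs with three eigenvalues and two valencies\<close>

lemma sum_lessThan_add:
  "(\<Sum>k<n + m. f k) = (\<Sum>k<n. f k) + (\<Sum>k<m. f (n + k))" for f :: "nat \<Rightarrow> 'a :: comm_monoid_add"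
  by (induction m) (simp_all add: add.assoc)

text \<open>Here \<open>b\<close> is the common off-diagonal entry of the quotient matrix, and
  \<open>b1\<close>, \<open>b2\<close> are the two expressions that the eigenvector equation gives
  for it. Equating them and cancelling \<open>a1 + a2\<close> yields \<open>b = a1 * a2\<close>; the
  norm condition then evaluates this product.\<close>

lemma three_eigenvalue_scalars:
  fixes a1 a2 \<theta>0 \<theta> m b n :: real
  assumes a: "a1 > a2" "a2 \<ge> 0" and m: "m = \<theta> * (\<theta> + 1)" and \<theta>0: "\<theta>0 = n - 1 - \<theta>"
    and norm: "n * (a1\<^sup>2 + a2\<^sup>2) = (\<theta>0 - \<theta>) * (\<theta>0 + \<theta> + 1)" and n: "n \<noteq> 0"
    and b1: "b * (a1 - a2) = (m + a1\<^sup>2 - \<theta>0) * a1"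
    and b2: "b * (a1 - a2) = (\<theta>0 - (m + a2\<^sup>2)) * a2"
  shows "b = \<theta>\<^sup>2"
proof -
  have "n * (a1\<^sup>2 + a2\<^sup>2) = n * (n - 1 - 2 * \<theta>)"
    unfolding norm \<theta>0 by (simp add: algebra_simps)
  then have s: "a1\<^sup>2 + a2\<^sup>2 = n - 1 - 2 * \<theta>" using n by simp
  have "(a1 + a2) * (m - \<theta>0 + a1\<^sup>2 - a1 * a2 + a2\<^sup>2) = 0"
    using b1 b2 by (simp add: algebra_simps power2_eq_square)
  then have e: "m - \<theta>0 + a1\<^sup>2 - a1 * a2 + a2\<^sup>2 = 0" using a by simp
  then have "m + a1\<^sup>2 - \<theta>0 = (a1 - a2) * a2" by (simp add: algebra_simps power2_eq_square)
  then have "b * (a1 - a2) = a1 * a2 * (a1 - a2)" using b1 by (simp only: ac_simps)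
  then have "b = a1 * a2" using a by (simp add: mult.commute)
  with e s m \<theta>0 show ?thesis by (simp add: algebra_simps power2_eq_square)
qed

text \<open>This extracts what the determinant computation requires of the second valency class: a
  constant block of \<open>M\<close> and constant row sums within the class, both expressed through
  the same number \<open>a2\<close>.\<close>

lemma two_valency_three_eigenvalues:
  fixes A :: "real mat"
  assumes A: "A \<in> carrier_mat (n + n) (n + n)" and sym: "transpose_mat A = A"
    and bin: "\<And>i j. i < n + n \<Longrightarrow> j < n + n \<Longrightarrow> A $$ (i, j) \<in> {0, 1}"
    and diag: "\<And>i. i < n + n \<Longrightarrow> A $$ (i, i) = 0"
    and deg1: "\<And>i. i < n \<Longrightarrow> (\<Sum>j<n + n. A $$ (i, j)) = K1"
    and deg2: "\<And>i. i < n \<Longrightarrow> (\<Sum>j<n + n. A $$ (n + i, j)) = K2"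
    and K: "K1 > K2" and n: "n > 0"
    and cp: "char_poly A = (\<Prod>e\<leftarrow>\<theta>0 # replicate n \<theta> @ replicate (n - 1) (- \<theta> - 1). [:- e, 1:])"
    and largest: "\<theta>0 > \<theta>" "\<theta>0 > - \<theta> - 1"
  defines "M \<equiv> A * A + A - (\<theta> * (\<theta> + 1)) \<cdot>\<^sub>m 1\<^sub>m (n + n)"
  obtains a2 where
    "\<And>i. i < n \<Longrightarrow> (\<Sum>j<n. A $$ (n + i, n + j)) = \<theta> + a2\<^sup>2"
    "\<And>i j. i < n \<Longrightarrow> j < n \<Longrightarrow> M $$ (n + i, n + j) = a2\<^sup>2"
    "A * M = \<theta>0 \<cdot>\<^sub>m M" "\<theta>0 = real n - 1 - \<theta>"
proof -
  define N where "N = n + n"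
  note A = A[folded N_def]
  define es where "es = \<theta>0 # replicate n \<theta> @ replicate (n - 1) (- \<theta> - 1)"
  note cp = cp[folded es_def]
  define m where "m = \<theta> * (\<theta> + 1)"
  define \<tau> where "\<tau> = - \<theta> - 1"
  define S where "S x = A - x \<cdot>\<^sub>m 1\<^sub>m N" for x
  have S: "S x \<in> carrier_mat N N" for x using A by (auto simp: S_def)
  \<comment> \<open>\<open>\<tau>\<close> is the third eigenvalue; the factorization holds because
    \<open>\<theta> + \<tau> = - 1\<close> and \<open>\<theta> * \<tau> = - m\<close>.\<close>
  have M: "M = S \<theta> * S \<tau>"
    unfolding S_def minus_smult_one_mult[OF A] M_def N_def[symmetric] using A
    by (intro eq_matI) (auto simp: \<tau>_def algebra_simps simp del: index_mult_mat(1))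
  have Mc: "M \<in> carrier_mat N N" unfolding M by (intro mult_carrier_mat[of _ N N] S)
  have "S \<theta>0 * M = 0\<^sub>m N N"
    unfolding M S_def
    by (rule symmetric_mat_annihilated[OF A sym cp]) (auto simp: es_def \<tau>_def)
  moreover have SM': "S x * M = A * M - x \<cdot>\<^sub>m M" for x
    unfolding S_def using A Mc by (subst minus_mult_distrib_mat[of _ N N _ _ N])
      (auto simp: mult_smult_assoc_mat[OF one_carrier_mat Mc])
  ultimately have AMz: "A * M - \<theta>0 \<cdot>\<^sub>m M = 0\<^sub>m N N" by simp
  have AM: "A * M = \<theta>0 \<cdot>\<^sub>m M"
  proof (rule eq_matI, goal_cases)
    case (1 i j)
    then have ij: "i < N" "j < N" using Mc by auto
    then have "(A * M - \<theta>0 \<cdot>\<^sub>m M) $$ (i, j) = (A * M) $$ (i, j) - (\<theta>0 \<cdot>\<^sub>m M) $$ (i, j)"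
      using A Mc by (intro index_minus_mat) auto
    then show ?case unfolding AMz using ij by simp
  qed (use A Mc in auto)
  have SM: "S x * M = (\<theta>0 - x) \<cdot>\<^sub>m M" for x
    unfolding SM' AM using Mc by (intro eq_matI) (auto simp: algebra_simps)
  \<comment> \<open>The value at \<open>\<theta>0\<close> of the quadratic polynomial that defines
    \<open>M\<close>. It is both the scalar in \<open>M * M = \<phi> M\<close> and the trace of
    \<open>M\<close>, since the other eigenvalues of \<open>A\<close> are roots of that
    polynomial.\<close>
  define \<phi> where "\<phi> = (\<theta>0 - \<theta>) * (\<theta>0 - \<tau>)"
  have \<phi>: "\<phi> > 0" using largest by (simp add: \<phi>_def \<tau>_def)
  have "M * M = S \<theta> * (S \<tau> * M)"
    unfolding M by (rule assoc_mult_mat[OF S S Mc[unfolded M]])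
  also have "\<dots> = (\<theta>0 - \<tau>) \<cdot>\<^sub>m (S \<theta> * M)"
    unfolding SM[of \<tau>] using S Mc by (rule mult_smult_distrib)
  also have "\<dots> = \<phi> \<cdot>\<^sub>m M"
    unfolding SM using Mc by (intro eq_matI) (auto simp: \<phi>_def)
  finally have MM: "M * M = \<phi> \<cdot>\<^sub>m M" .
  have prod_entry: "(X * Y) $$ (i, j) = (\<Sum>k<N. X $$ (i, k) * Y $$ (k, j))"
    if "X \<in> carrier_mat N N" "Y \<in> carrier_mat N N" "i < N" "j < N" for X Y :: "real mat" and i j
    using that by (auto simp: scalar_prod_def atLeast0LessThan intro!: sum.cong)
  have Asym: "A $$ (i, j) = A $$ (j, i)" if "i < N" "j < N" for i j
    using A that by (subst sym[symmetric]) auto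
  have Mij: "M $$ (i, j) = (\<Sum>k<N. A $$ (i, k) * A $$ (k, j)) + A $$ (i, j) - (if i = j then m else 0)"
    if "i < N" "j < N" for i j
  proof -
    have "M $$ (i, j) = (A * A) $$ (i, j) + A $$ (i, j) - (if i = j then m else 0)"
      unfolding M_def N_def[symmetric] using A that
      by (auto simp: m_def simp del: index_mult_mat(1))
    with prod_entry[OF A A that] show ?thesis by simp
  qed
  have Msym: "M $$ (i, j) = M $$ (j, i)" if "i < N" "j < N" for i j
    using that Asym by (auto simp: Mij intro!: sum.cong)
  have tr: "(\<Sum>i<N. M $$ (i, i)) = \<phi>"
  proof -
    have "(\<Sum>i<N. M $$ (i, i)) = mat_trace M" using Mc by (auto simp: mat_trace_def)
    also have "\<dots> = (\<Sum>e\<leftarrow>es. (e - \<theta>) * (e - \<tau>))"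
      unfolding M S_def by (rule mat_trace_char_poly(2)[OF A cp])
    also have "\<dots> = \<phi>" by (simp add: es_def \<phi>_def \<tau>_def sum_list_replicate)
    finally show ?thesis .
  qed
  \<comment> \<open>The zero diagonal makes the eigenvalues sum to zero, that is,
    \<open>\<theta>0 + n \<theta> - (n - 1) (\<theta> + 1) = 0\<close>.\<close>
  have "mat_trace A = 0" using A diag by (auto simp: mat_trace_def N_def)
  then have "sum_list es = 0" using mat_trace_char_poly(1)[OF A cp] by simp
  then have \<theta>0: "\<theta>0 = real n - 1 - \<theta>"
    using n by (simp add: es_def sum_list_replicate of_nat_diff algebra_simps)
  have MMij: "(\<Sum>k<N. M $$ (i, k) * M $$ (k, j)) = \<phi> * M $$ (i, j)" if "i < N" "j < N" for i j
    using prod_entry[OF Mc Mc that] Mc that unfolding MM by simp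
  have r1: "(M $$ (i, j))\<^sup>2 = M $$ (i, i) * M $$ (j, j)" "M $$ (i, i) \<ge> 0"
    if ij: "i < N" "j < N" for i j
    using projection_trace_rank_one[where M = "\<lambda>i j. M $$ (i, j)", OF \<phi> _ _ tr ij] Msym MMij
    by blast+
  have Mnn: "M $$ (i, j) \<ge> 0" if "i < N" "j < N" for i j
  proof (cases "i = j")
    case True with r1(2)[OF that] show ?thesis by simp
  next
    case False
    have "A $$ (k, l) \<ge> 0" if "k < N" "l < N" for k l
      using bin[of k l] that by (auto simp: N_def)
    then show ?thesis using False that by (auto simp: Mij intro!: add_nonneg_nonneg sum_nonneg)
  qed
  \<comment> \<open>Rank one fixes the entries only up to sign; nonnegativity selects the positive
    root, so the vector \<alpha> has entries \<open>sqrt (M $$ (i, i))\<close>.\<close>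
  have Mrank: "M $$ (i, j) = sqrt (M $$ (i, i)) * sqrt (M $$ (j, j))" if "i < N" "j < N" for i j
    using r1(1)[OF that] Mnn[OF that] by (metis real_sqrt_mult real_sqrt_unique)
  \<comment> \<open>For a symmetric 0/1 matrix the diagonal of \<open>A * A\<close> consists of the
    row sums, that is, the valencies.\<close>
  have Mii: "M $$ (i, i) = (\<Sum>k<N. A $$ (i, k)) - m" if "i < N" for i
  proof -
    have "A $$ (i, k) * A $$ (k, i) = A $$ (i, k)" if "k < N" for k
      using bin[of i k] Asym[OF that \<open>i < N\<close>] that \<open>i < N\<close> by (auto simp: N_def)
    then have "(\<Sum>k<N. A $$ (i, k) * A $$ (k, i)) = (\<Sum>k<N. A $$ (i, k))"
      by (intro sum.cong) auto
    then show ?thesis using Mij[OF that that] that diag by (simp add: N_def)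
  qed
  define a1 where "a1 = sqrt (K1 - m)"
  define a2 where "a2 = sqrt (K2 - m)"
  have M1: "M $$ (i, i) = K1 - m" if "i < n" for i
    using Mii[of i] deg1[OF that] that by (simp add: N_def)
  have M2: "M $$ (n + i, n + i) = K2 - m" if "i < n" for i
    using Mii[of "n + i"] deg2[OF that] that by (simp add: N_def)
  have "K2 - m \<ge> 0" using M2[OF n] Mnn[of "n + 0" "n + 0"] n by (simp add: N_def)
  then have a: "a1 > a2" "a2 \<ge> 0" and sq: "a1\<^sup>2 = K1 - m" "a2\<^sup>2 = K2 - m"
    using K by (auto simp: a1_def a2_def)
  have tr': "real n * (a1\<^sup>2 + a2\<^sup>2) = \<phi>"
    unfolding tr[symmetric] N_def sum_lessThan_add sq distrib_left by (simp add: M1 M2)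
  \<comment> \<open>Column 0 of \<open>A * M = \<theta>0 M\<close>. Index 0 belongs to the first
    class, so this column is \<open>a1\<close> times \<alpha>, and the positive factor
    \<open>a1\<close> cancels.\<close>
  have eig: "(\<Sum>k<n. A $$ (i, k)) * a1 + (\<Sum>k<n. A $$ (i, n + k)) * a2 = \<theta>0 * sqrt (M $$ (i, i))"
    if i: "i < N" for i
  proof -
    have 0: "0 < N" using n by (simp add: N_def)
    have s0: "sqrt (M $$ (0, 0)) = a1" using M1[OF n] by (simp add: a1_def)
    have "(\<Sum>k<N. A $$ (i, k) * M $$ (k, 0)) = \<theta>0 * M $$ (i, 0)"
      using prod_entry[OF A Mc i 0] Mc i 0 unfolding AM by simp
    moreover have "(\<Sum>k<N. A $$ (i, k) * M $$ (k, 0)) = (\<Sum>k<N. A $$ (i, k) * sqrt (M $$ (k, k))) * a1"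
      unfolding sum_distrib_right using Mrank[OF _ 0] by (intro sum.cong) (auto simp: s0)
    moreover have "M $$ (i, 0) = sqrt (M $$ (i, i)) * a1"
      using Mrank[OF i 0] unfolding s0 .
    ultimately have "(\<Sum>k<N. A $$ (i, k) * sqrt (M $$ (k, k))) = \<theta>0 * sqrt (M $$ (i, i))"
      using a by simp
    moreover have "(\<Sum>k<N. A $$ (i, k) * sqrt (M $$ (k, k)))
        = (\<Sum>k<n. A $$ (i, k)) * a1 + (\<Sum>k<n. A $$ (i, n + k)) * a2"
      unfolding N_def sum_lessThan_add sum_distrib_right
      using M1 M2 by (auto simp: a1_def a2_def intro!: arg_cong2[of _ _ _ _ "(+)"] sum.cong)
    ultimately show ?thesis by simp
  qed
  \<comment> \<open>The solutions of \<open>(K1 - b) a1 + b a2 = \<theta>0 a1\<close> and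
    \<open>b' a1 + (K2 - b') a2 = \<theta>0 a2\<close>. They do not depend on the row, so the
    partition is equitable.\<close>
  define b where "b = (K1 - \<theta>0) * a1 / (a1 - a2)"
  define b' where "b' = (\<theta>0 - K2) * a2 / (a1 - a2)"
  have b: "b * (a1 - a2) = (K1 - \<theta>0) * a1" and b': "b' * (a1 - a2) = (\<theta>0 - K2) * a2"
    using a by (auto simp: b_def b'_def)
  have row1: "(\<Sum>k<n. A $$ (i, n + k)) = b" if "i < n" for i
  proof -
    have "(\<Sum>k<n. A $$ (i, k)) = K1 - (\<Sum>k<n. A $$ (i, n + k))"
      using deg1[OF that] unfolding sum_lessThan_add by simp
    with eig[of i] that have "(\<Sum>k<n. A $$ (i, n + k)) * (a1 - a2) = b * (a1 - a2)"
      unfolding b by (simp add: N_def M1 a1_def[symmetric] algebra_simps)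
    then show ?thesis using a by simp
  qed
  have row2: "(\<Sum>k<n. A $$ (n + i, k)) = b'" if "i < n" for i
  proof -
    have "(\<Sum>k<n. A $$ (n + i, n + k)) = K2 - (\<Sum>k<n. A $$ (n + i, k))"
      using deg2[OF that] unfolding sum_lessThan_add by simp
    moreover have "(\<Sum>k<n. A $$ (n + i, k)) * a1 + (\<Sum>k<n. A $$ (n + i, n + k)) * a2 = \<theta>0 * a2"
      using eig[of "n + i"] that by (simp add: N_def M2 a2_def)
    ultimately have "(\<Sum>k<n. A $$ (n + i, k)) * a1 + (K2 - (\<Sum>k<n. A $$ (n + i, k))) * a2 = \<theta>0 * a2"
      by (simp only:)
    then have "(\<Sum>k<n. A $$ (n + i, k)) * (a1 - a2) = b' * (a1 - a2)"
      unfolding b' by (simp add: algebra_simps)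
    then show ?thesis using a by simp
  qed
  \<comment> \<open>Double counting of the edges between the classes; as both have size
    \<open>n\<close>, the two cross row sums agree.\<close>
  have "real n * b = (\<Sum>i<n. \<Sum>k<n. A $$ (i, n + k))" using row1 by simp
  also have "\<dots> = (\<Sum>k<n. \<Sum>i<n. A $$ (n + k, i))"
    by (subst sum.swap) (auto intro!: sum.cong Asym simp: N_def)
  also have "\<dots> = real n * b'" using row2 by simp
  finally have bb: "b = b'" using n by simp
  have "b = \<theta>\<^sup>2"
  proof (rule three_eigenvalue_scalars[OF a m_def \<theta>0])
    show "real n * (a1\<^sup>2 + a2\<^sup>2) = (\<theta>0 - \<theta>) * (\<theta>0 + \<theta> + 1)"
      using tr' by (simp add: \<phi>_def \<tau>_def algebra_simps)
  qed (use n b b' bb sq in auto)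
  \<comment> \<open>The row sum within the class is \<open>K2 - b\<close>, where
    \<open>K2 = m + a2\<^sup>2\<close> and \<open>b = \<theta>\<^sup>2\<close>.\<close>
  then have "(\<Sum>j<n. A $$ (n + i, n + j)) = \<theta> + a2\<^sup>2" if "i < n" for i
    using deg2[OF that] row2[OF that] bb unfolding sum_lessThan_add sq
    by (simp add: m_def algebra_simps power2_eq_square)
  moreover have "M $$ (n + i, n + j) = a2\<^sup>2" if "i < n" "j < n" for i j
    using Mrank[of "n + i" "n + j"] that M2[OF that(1)] M2[OF that(2)]
    by (simp add: N_def a2_def power2_eq_square)
  ultimately show thesis using that AM \<theta>0 by blast
qed

text \<open>The two characteristic polynomials are compared at each real \<open>x\<close> outside
  four exceptional values. Agreement at infinitely many points makes them equal.\<close>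

lemma char_poly_complementary_block:
  fixes A A1 A2 B :: "real mat"
  assumes A: "A = four_block_mat A1 (transpose_mat B) B A2"
    and c: "A1 \<in> carrier_mat n n" "B \<in> carrier_mat n n" "A2 \<in> carrier_mat n n"
    and n: "n > 0"
    and cp: "char_poly A = (\<Prod>e\<leftarrow>\<theta>0 # replicate n \<theta> @ replicate (n - 1) (- \<theta> - 1). [:- e, 1:])"
    and M: "M = A * A + A - (\<theta> * (\<theta> + 1)) \<cdot>\<^sub>m 1\<^sub>m (n + n)" "A * M = \<theta>0 \<cdot>\<^sub>m M"
    and M22: "\<And>i j. i < n \<Longrightarrow> j < n \<Longrightarrow> M $$ (n + i, n + j) = p"
    and rows: "\<And>i. i < n \<Longrightarrow> (\<Sum>j<n. A2 $$ (i, j)) = \<theta> + p"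
    and \<theta>0: "\<theta>0 = real n - 1 - \<theta>"
  shows "char_poly A1 = char_poly (all_ones_mat n - 1\<^sub>m n - A2)"
proof -
  let ?C = "all_ones_mat n - 1\<^sub>m n - A2"
  have C: "?C \<in> carrier_mat n n" using c by (auto simp: all_ones_mat_def)
  have Ac: "A \<in> carrier_mat (n + n) (n + n)" using A c by auto
  have Mc: "M \<in> carrier_mat (n + n) (n + n)" using M(1) Ac by auto
  have main: "poly (char_poly A1) x = poly (char_poly ?C) x"
    \<comment> \<open>\<open>\<theta>0\<close> and \<open>\<theta>0 - p\<close> are excluded as
      zeros of denominators, the other two values as zeros of \<open>f\<close>, which is cancelled
      at the end.\<close>
    if x: "x \<noteq> \<theta>0" "x \<noteq> \<theta>" "x \<noteq> - \<theta> - 1" "x \<noteq> \<theta>0 - p" for x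
  proof -
    define f where "f = (x - \<theta>) * (x + \<theta> + 1)"
    \<comment> \<open>\<open>X\<close> will be \<open>f\<close> times the inverse of
      \<open>x I - A\<close>. The matrix \<open>?Z * Y\<close> equals \<open>M\<close> up to a
      scalar matrix, and \<open>?Z\<close> acts on \<open>M\<close> as \<open>\<theta>0 - x\<close>,
      so a multiple of \<open>M\<close> added to \<open>Y\<close> corrects the product.
      \<open>Y\<close> is written as a difference to match
      \<open>minus_smult_one_mult\<close>.\<close>
    define Y where "Y = A - (- (x + 1)) \<cdot>\<^sub>m 1\<^sub>m (n + n)"
    define X where "X = Y + (1 / (x - \<theta>0)) \<cdot>\<^sub>m M"
    let ?Z = "A - x \<cdot>\<^sub>m 1\<^sub>m (n + n)"
    have Z: "?Z \<in> carrier_mat (n + n) (n + n)" and Y: "Y \<in> carrier_mat (n + n) (n + n)"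
      using Ac by (auto simp: Y_def)
    have X: "X \<in> carrier_mat (n + n) (n + n)" using Y Mc by (auto simp: X_def)
    have "?Z * M = A * M - x \<cdot>\<^sub>m M"
      using Ac Mc by (subst minus_mult_distrib_mat[of _ "n + n" "n + n" _ _ "n + n"])
        (auto simp: mult_smult_assoc_mat[OF one_carrier_mat Mc])
    then have ZM: "?Z * M = (\<theta>0 - x) \<cdot>\<^sub>m M"
      unfolding M(2) using Mc by (intro eq_matI) (auto simp: algebra_simps)
    have ZY: "?Z * Y = A * A + A - (x * (x + 1)) \<cdot>\<^sub>m 1\<^sub>m (n + n)"
      unfolding Y_def minus_smult_one_mult[OF Ac] using Ac
      by (intro eq_matI) (auto simp: algebra_simps simp del: index_mult_mat(1))
    have "?Z * X = ?Z * Y + (1 / (x - \<theta>0)) \<cdot>\<^sub>m (?Z * M)"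
      unfolding X_def using Z Y Mc
      by (subst mult_add_distrib_mat[of _ "n + n" "n + n" _ "n + n"])
        (auto simp: mult_smult_distrib[OF Z Mc])
    also have "(1 / (x - \<theta>0)) \<cdot>\<^sub>m (?Z * M) = (- 1) \<cdot>\<^sub>m M"
    proof -
      have "1 / (x - \<theta>0) * ((\<theta>0 - x) * y) = - y" for y using x(1) by (simp add: field_simps)
      then show ?thesis unfolding ZM by (intro eq_matI) (auto simp del: times_divide_eq_left)
    qed
    also have "?Z * Y + (- 1) \<cdot>\<^sub>m M = (- f) \<cdot>\<^sub>m 1\<^sub>m (n + n)"
    proof (rule eq_matI, goal_cases)
      case (1 i j)
      then show ?case unfolding ZY M(1) using Ac
        by (simp add: f_def algebra_simps del: index_mult_mat(1))
    qed (use Ac Mc Z Y in auto)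
    finally have ZX: "?Z * X = (- f) \<cdot>\<^sub>m 1\<^sub>m (n + n)" .
    have neg: "x \<cdot>\<^sub>m 1\<^sub>m (n + n) - A = (- 1) \<cdot>\<^sub>m ?Z" using Ac by (intro eq_matI) auto
    have "(x \<cdot>\<^sub>m 1\<^sub>m (n + n) - A) * X = (- 1) \<cdot>\<^sub>m (?Z * X)"
      unfolding neg by (rule mult_smult_assoc_mat[OF Z X])
    then have inv: "(x \<cdot>\<^sub>m 1\<^sub>m (n + n) - A) * X = f \<cdot>\<^sub>m 1\<^sub>m (n + n)"
      unfolding ZX by (auto intro!: eq_matI)
    obtain X11 X12 X21 X22 where sp: "split_block X n n = (X11, X12, X21, X22)"
      by (metis prod_cases4)
    note Xs = split_block[OF sp carrier_matD[OF X]]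
    have blk: "x \<cdot>\<^sub>m 1\<^sub>m (n + n) - A
        = four_block_mat (x \<cdot>\<^sub>m 1\<^sub>m n - A1) (- transpose_mat B) (- B) (x \<cdot>\<^sub>m 1\<^sub>m n - A2)"
      unfolding A using c by (intro eq_matI) auto
    have "det (x \<cdot>\<^sub>m 1\<^sub>m (n + n) - A) * det X22 = det (x \<cdot>\<^sub>m 1\<^sub>m n - A1) * f ^ n"
      unfolding blk
      by (rule det_complementary_block[of _ _ _ _ _ _ X11 X12 X21])
        (use c Xs inv[unfolded Xs(5) blk] in auto)
    then have jac: "poly (char_poly A) x * det X22 = poly (char_poly A1) x * f ^ n"
      using poly_char_poly[OF Ac] poly_char_poly[OF c(1)] by simp
    let ?D = "x \<cdot>\<^sub>m 1\<^sub>m n - ?C"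
    let ?s = "1 + p / (x - \<theta>0)"
    \<comment> \<open>The lower right block of \<open>X\<close> is
      \<open>A2 + (x + 1) I + (p / (x - \<theta>0)) J\<close>, whereas
      \<open>?D = A2 + (x + 1) I - J\<close>.\<close>
    have "X22 = ?D + mat n n (\<lambda>_. ?s)"
    proof (rule eq_matI, goal_cases)
      case (1 i j)
      then have ij: "i < n" "j < n" using C by auto
      have "X22 $$ (i, j) = X $$ (n + i, n + j)"
        using ij Xs(1-4) unfolding Xs(5) by simp
      also have "\<dots> = A2 $$ (i, j) + (if i = j then x + 1 else 0) + p / (x - \<theta>0)"
        using ij Ac Mc M22[OF ij] c unfolding X_def Y_def A by auto
      also have "\<dots> = (?D + mat n n (\<lambda>_. ?s)) $$ (i, j)"
        using ij c by (auto simp: all_ones_mat_def)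
      finally show ?case .
    qed (use Xs(1-4) C in auto)
    moreover have "(\<Sum>j<n. ?D $$ (i, j)) = x - (\<theta>0 - p)" if i: "i < n" for i
    proof -
      have "(\<Sum>j<n. ?D $$ (i, j)) = (\<Sum>j<n. (if j = i then x + 1 else 0) - 1 + A2 $$ (i, j))"
        using i c by (intro sum.cong) (auto simp: all_ones_mat_def)
      also have "\<dots> = x - (\<theta>0 - p)"
        using i by (simp add: sum.distrib sum_subtractf rows \<theta>0)
      finally show ?thesis .
    qed
    moreover have "?D \<in> carrier_mat n n" by (rule minus_carrier_mat[OF C])
    ultimately have "det X22 = det ?D * (1 + real n * (?s / (x - (\<theta>0 - p))))"
      using x(4) det_plus_const[of ?D n "x - (\<theta>0 - p)" ?s] by auto
    \<comment> \<open>The numerator of \<open>?s\<close> is exactly the row sum of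
      \<open>?D\<close>, so \<open>p\<close> disappears.\<close>
    also have "?s / (x - (\<theta>0 - p)) = 1 / (x - \<theta>0)"
      using x by (simp add: divide_simps)
    also have "1 + real n * (1 / (x - \<theta>0)) = (x + \<theta> + 1) / (x - \<theta>0)"
      using x(1) unfolding \<theta>0 by (simp add: divide_simps)
    also have "det ?D = poly (char_poly ?C) x" using poly_char_poly[OF C] by simp
    finally have dX: "det X22 = poly (char_poly ?C) x * ((x + \<theta> + 1) / (x - \<theta>0))" .
    have "poly (char_poly A) x = (x - \<theta>0) * (x - \<theta>) ^ n * (x + \<theta> + 1) ^ (n - 1)"
      unfolding cp by (simp add: prod_list_replicate algebra_simps)
    \<comment> \<open>The scalar factor removes the simple root \<open>\<theta>0\<close> and
      supplies the one factor \<open>x + \<theta> + 1\<close> missing from the power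
      \<open>n - 1\<close>.\<close>
    then have "poly (char_poly A) x * ((x + \<theta> + 1) / (x - \<theta>0)) = f ^ n"
      using x(1) n unfolding f_def by (cases n) (auto simp: power_mult_distrib)
    then have "poly (char_poly ?C) x * f ^ n = poly (char_poly A1) x * f ^ n"
      using jac unfolding dX by (metis mult.assoc mult.commute)
    moreover have "f \<noteq> 0" using x by (auto simp: f_def)
    ultimately show ?thesis by simp
  qed
  have "char_poly A1 - char_poly ?C = 0"
  proof (rule ccontr)
    assume "char_poly A1 - char_poly ?C \<noteq> 0"
    then have "finite {x. poly (char_poly A1 - char_poly ?C) x = 0}" by (rule poly_roots_finite)
    moreover have "- {\<theta>0, \<theta>, - \<theta> - 1, \<theta>0 - p} \<subseteq> {x. poly (char_poly A1 - char_poly ?C) x = 0}"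
      using main by auto
    ultimately have "finite (- {\<theta>0, \<theta>, - \<theta> - 1, \<theta>0 - p} :: real set)" by (rule finite_subset[rotated])
    then show False by (simp add: finite_compl infinite_UNIV_char_0)
  qed
  then show ?thesis by simp
qed

section \<open>From the graph to its adjacency matrix\<close>

lemma out_degree_eq_card_successors:
  assumes "nomulti_digraph G"
  shows "out_degree G v = card {w. v \<rightarrow>\<^bsub>G\<^esub> w}"
proof -
  interpret nomulti_digraph G by (rule assms)
  \<comment> \<open>Without parallel arcs, an arc leaving \<open>v\<close> is determined by its
    head.\<close>
  have "inj_on (head G) (out_arcs G v)"
    by (rule inj_onI) (auto simp: out_arcs_def arc_to_ends_def intro: no_multi_arcs)
  moreover have "head G ` out_arcs G v = {w. v \<rightarrow>\<^bsub>G\<^esub> w}"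
    by (force simp: out_arcs_def arcs_ends_conv)
  ultimately show ?thesis unfolding out_degree_def by (metis card_image)
qed

lemma adjacency_mat_row_sum:
  assumes "graph G" and vs: "distinct vs" "set vs = verts G" and i: "i < length vs"
  shows "(\<Sum>j<length vs. adjacency_mat G vs $$ (i, j)) = real (out_degree G (vs ! i))"
proof -
  interpret graph G by (rule assms)
  have "(\<Sum>j<length vs. adjacency_mat G vs $$ (i, j))
      = (\<Sum>j<length vs. if vs ! i \<rightarrow>\<^bsub>G\<^esub> vs ! j then 1 else 0)"
    using i by (intro sum.cong) (auto simp: adjacency_mat_def)
  also have "\<dots> = (\<Sum>w\<in>set vs. if vs ! i \<rightarrow>\<^bsub>G\<^esub> w then 1 else 0)"
    by (rule sum.reindex_bij_betw[OF bij_betw_nth[OF vs(1) refl refl]])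
  also have "\<dots> = real (card {w \<in> set vs. vs ! i \<rightarrow>\<^bsub>G\<^esub> w})"
    by (simp add: sum.If_cases Int_def)
  also have "{w \<in> set vs. vs ! i \<rightarrow>\<^bsub>G\<^esub> w} = {w. vs ! i \<rightarrow>\<^bsub>G\<^esub> w}"
    unfolding vs(2) by (auto simp: arcs_ends_conv)
  finally show ?thesis
    by (simp add: out_degree_eq_card_successors[OF nomulti_digraph])
qed

theorem lemma7p5:
  fixes G :: "('v, 'e) pre_digraph"
    and vs1 vs2 :: "'v list"
    and A A1 A2 B :: "real mat"
    and n k1 k2 :: nat
    and \<theta>0 \<theta> k11 k12 k21 k22 :: real
  assumes "graph G"
    and "Digraph_Component.connected G"
    and valencies: "out_degree G ` verts G = {k1, k2}" "k1 > k2"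
    and class_sizes: "card (valency_class G k1) = n" "card (valency_class G k2) = n"
    and order1: "distinct vs1" "set vs1 = valency_class G k1"
    and order2: "distinct vs2" "set vs2 = valency_class G k2"
    and adjacency: "A = adjacency_mat G (vs1 @ vs2)"
    and blocks: "A = four_block_mat A1 (transpose_mat B) B A2"
      "A1 \<in> carrier_mat n n" "B \<in> carrier_mat n n" "A2 \<in> carrier_mat n n"
    and quotient: "quotient_mat G [valency_class G k1, valency_class G k2]
      = mat_of_rows_list 2 [[k11, k12], [k21, k22]]"
    and "spectrum": "eigenvalue_mset A
      = {#\<theta>0#} + replicate_mset n \<theta> + replicate_mset (n - 1) (- \<theta> - 1)"
    and three_eigenvalues: "n \<ge> 2" "\<theta> \<noteq> - \<theta> - 1"
    and largest: "\<theta>0 > \<theta>" "\<theta>0 > - \<theta> - 1"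
  shows "cospectral A1 (all_ones_mat n - 1\<^sub>m n - A2)"
proof -
  interpret graph G by (rule assms)
  have len: "length vs1 = n" "length vs2 = n"
    using distinct_card[OF order1(1)] distinct_card[OF order2(1)] order1(2) order2(2) class_sizes
    by auto
  define vs where "vs = vs1 @ vs2"
  have lvs: "length vs = n + n" using len by (simp add: vs_def)
  have "verts G = valency_class G k1 \<union> valency_class G k2"
    using valencies(1) by (auto simp: valency_class_def)
  then have vs: "distinct vs" "set vs = verts G"
    using order1 order2 valencies(2) by (auto simp: vs_def valency_class_def)
  have A: "A = adjacency_mat G vs" using adjacency by (simp add: vs_def)
  have Ac: "A \<in> carrier_mat (n + n) (n + n)" using lvs by (simp add: A adjacency_mat_def)
  have entry: "A $$ (i, j) = (if vs ! i \<rightarrow>\<^bsub>G\<^esub> vs ! j then 1 else 0)"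
    if "i < n + n" "j < n + n" for i j
    using that lvs by (simp add: A adjacency_mat_def)
  have sym: "transpose_mat A = A"
    using Ac by (intro eq_matI) (auto simp: entry intro: arcs_ends_symmetric[OF sym_arcs])
  have deg1: "(\<Sum>j<n + n. A $$ (i, j)) = real k1" if "i < n" for i
  proof -
    have "vs ! i \<in> set vs1" using that len by (simp add: vs_def nth_append)
    then show ?thesis
      using adjacency_mat_row_sum[OF assms(1) vs, of i] that lvs order1(2)
      by (simp add: A valency_class_def)
  qed
  have deg2: "(\<Sum>j<n + n. A $$ (n + i, j)) = real k2" if "i < n" for i
  proof -
    have "vs ! (n + i) \<in> set vs2" using that len by (simp add: vs_def nth_append)
    then show ?thesis
      using adjacency_mat_row_sum[OF assms(1) vs, of "n + i"] that lvs order2(2)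
      by (simp add: A valency_class_def)
  qed
  \<comment> \<open>The given spectrum contains \<open>1 + n + (n - 1) = n + n\<close> roots, which
    is the degree, so the polynomial splits.\<close>
  have "char_poly A = (\<Prod>a\<in>#proots (char_poly A). [:- a, 1:])"
    using degree_monic_char_poly[OF Ac] "spectrum" three_eigenvalues(1)
    by (intro prod_mset_proots) (auto simp: eigenvalue_mset_def)
  also have "proots (char_poly A) = mset (\<theta>0 # replicate n \<theta> @ replicate (n - 1) (- \<theta> - 1))"
    using "spectrum" by (simp add: eigenvalue_mset_def)
  finally have cp: "char_poly A
      = (\<Prod>e\<leftarrow>\<theta>0 # replicate n \<theta> @ replicate (n - 1) (- \<theta> - 1). [:- e, 1:])"
    by (metis mset_map prod_mset_prod_list)
  have n: "n > 0" using three_eigenvalues(1) by simp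
  define M where "M = A * A + A - (\<theta> * (\<theta> + 1)) \<cdot>\<^sub>m 1\<^sub>m (n + n)"
  obtain a2 where rows: "\<And>i. i < n \<Longrightarrow> (\<Sum>j<n. A $$ (n + i, n + j)) = \<theta> + a2\<^sup>2"
    and M22: "\<And>i j. i < n \<Longrightarrow> j < n \<Longrightarrow> M $$ (n + i, n + j) = a2\<^sup>2"
    and AM: "A * M = \<theta>0 \<cdot>\<^sub>m M" and \<theta>0: "\<theta>0 = real n - 1 - \<theta>"
    unfolding M_def
    by (rule two_valency_three_eigenvalues[OF Ac sym _ _ deg1 deg2 _ n cp largest])
      (use valencies(2) entry adj_not_same in \<open>auto simp del: index_mult_mat(1)\<close>)
  have "(\<Sum>j<n. A2 $$ (i, j)) = \<theta> + a2\<^sup>2" if "i < n" for i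
    using rows[OF that] that blocks by simp
  then have "char_poly A1 = char_poly (all_ones_mat n - 1\<^sub>m n - A2)"
    using char_poly_complementary_block[OF blocks n cp M_def AM M22 _ \<theta>0] by blast
  then show ?thesis by (simp add: cospectral_def eigenvalue_mset_def)
qed

end
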